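(* Let $\mathbb X\subseteq\mathbb R^{n_{\mathrm x}}$ be convex and closed, let $\mathbb U\subseteq\mathbb R^{n_{\mathrm u}}$ and $\mathbb W\subseteq\mathbb R^{n_{\mathrm x}}$ be nonempty, convex and compact, let $f:\mathbb R^{n_{\mathrm x}}\times\mathbb R^{n_{\mathrm u}}\to\mathbb R^{n_{\mathrm x}}$ be Lipschitz continuous and satisfy Assumption (F) with constants $\gamma,\alpha$, and let $L:\mathbb X\times\mathbb U\to\mathbb R_+$ be non-negative, Lipschitz continuous and satisfy Assumption (L) with constants $\sigma,\beta$ (both assumptions are stated in the context). Let a configuration template $(G_1,G_2,h_2,V_i,s_i,E)$ as in the context be given, let $z\in\mathbb R^{\mathsf f}$ satisfy $Ez\le 0$, let $d\in\mathbb R$, let $M_z$ be the associated piecewise affine function, and let $v_i=V_iz$ for $i\in\{1,\dots,\mathsf v\}$. Let $u_1,\dots,u_{\mathsf v}\in\mathbb U$ be given and let the sets $\mathbb D_i$ and numbers $\kappa_i$ be defined as in the context. If $$M_z(v_i)+d\ \ge\ \max_{\delta\in\mathbb D_i}\ L(v_i,u_i)+\kappa_i+I_{\mathbb X}(v_i)+M_z(f(v_i,u_i)+\delta)$$ holds for all $i\in\{1,\dots,\mathsf v\}$, then $$M_z(x)+d\ \ge\ \min_{u\in\mathbb U}\max_{w\in\mathbb W}\ L(x,u)+I_{\mathbb X}(x)+M_z(f(x,u)+w)\qquad\text{for all }x\in\mathbb R^{n_{\mathrm x}}.$$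
   Context: Write $n=n_{\mathrm x}+1$ and $\Delta_n=\{\theta\in\mathbb R^n\mid \theta\ge 0,\ \sum_{i=1}^n\theta_i=1\}$. $\|\cdot\|$ is a fixed norm on $\mathbb R^{n_{\mathrm x}+n_{\mathrm u}}$, $\|\cdot\|_\infty$ is the max norm, $\mathrm{cvx}$ denotes the convex hull, and $e_n$ is the last unit vector of $\mathbb R^n$. The indicator function is $I_{\mathbb X}(x)=0$ if $x\in\mathbb X$ and $\infty$ otherwise. Extended-value conventions are used: any sum containing the term $I_{\mathbb X}(x)$ equals $\infty$ if $x\notin\mathbb X$ (even though $L$ is only defined on $\mathbb X\times\mathbb U$), and min/max are understood in the extended-value sense. Assumption (F): $\gamma,\alpha\ge 0$ are constants such that for all $v_1,\dots,v_n\in\mathbb X$ and $u_1,\dots,u_n\in\mathbb U$, $$\max_{\theta\in\Delta_n}\Big\|\sum_{i=1}^n\theta_i f(v_i,u_i)-f\Big(\sum_{i=1}^n\theta_iv_i,\sum_{i=1}^n\theta_iu_i\Big)\Big\|_\infty\le\gamma\cdot\max_{i,j}\left\|\begin{bmatrix}v_i-v_j\\ u_i-u_j\end{bmatrix}\right\|^\alpha .$$ Assumption (L): $\sigma\ge 0$, $\beta\ge 1$ are constants such that for all $v_1,\dots,v_n\in\mathbb X$ and $u_1,\dots,u_n\in\mathbb U$, $$\max_{\theta\in\Delta_n}\Big(L\Big(\sum_{i=1}^n\theta_iv_i,\sum_{i=1}^n\theta_iu_i\Big)-\sum_{i=1}^n\theta_iL(v_i,u_i)\Big)\le\sigma\cdot\max_{i,j}\left\|\begin{bmatrix}v_i-v_j\\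 u_i-u_j\end{bmatrix}\right\|^\beta .$$ Configuration template: matrices $G_1\in\mathbb R^{\mathsf f_1\times n_{\mathrm x}}$, $G_2\in\mathbb R^{\mathsf f_2\times n_{\mathrm x}}$ and a vector $h_2\in\mathbb R^{\mathsf f_2}$ with $h_2<0$ componentwise, such that $G_1x\le 0$ implies $x=0$; with $\mathsf f=\mathsf f_1+\mathsf f_2$, matrices $V_1,\dots,V_{\mathsf v}\in\mathbb R^{n_{\mathrm x}\times\mathsf f}$, vectors $s_1,\dots,s_{\mathsf v}\in\mathbb R^{\mathsf f}$, and an edge matrix $E\in\mathbb R^{\mathsf e\times\mathsf f}$. For $z=(z_1,z_2)\in\mathbb R^{\mathsf f_1}\times\mathbb R^{\mathsf f_2}$ put $$\mathcal P(z)=\left\{\begin{bmatrix}x\\ y\end{bmatrix}\in\mathbb R^{n_{\mathrm x}}\times\mathbb R\ \middle|\ G_1x\le z_1,\ G_2x+h_2y\le z_2\right\}.$$ The edge matrix encodes the combinatorial face configuration, in the sense that $Ez\le0$ holds if and only if $$\mathcal P(z)=\mathrm{cvx}\left(\begin{bmatrix}V_1z\\ s_1^\intercal z\end{bmatrix},\dots,\begin{bmatrix}V_{\mathsf v}z\\ s_{\mathsf v}^\intercal z\end{bmatrix}\right)+\mathbb R_+e_n ,$$ and the configuration specifies which vertices lie on which facets: for each row $k\in\{1,\dots,\mathsf f\}$ there is a set $F_k\subseteq\{1,\dots,\mathsf v\}$ (the vertices on the $k$-th facet) such that, for every $z$ with $Ez\le0$, the face of $\mathcal P(z)$ on which the $k$-th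 inequality is active equals $\mathrm{cvx}\{(V_iz,s_i^\intercal z)\mid i\in F_k\}$ if $k>\mathsf f_1$, and this convex hull plus $\mathbb R_+e_n$ if $k\le\mathsf f_1$. $\mathcal P(z)$ is the epigraph of $$M_z(x)=\begin{cases}\max_{i\in\{1,\dots,\mathsf f_2\}}\dfrac{(z_2-G_2x)_i}{(h_2)_i}&\text{if }G_1x\le z_1,\\ \infty&\text{otherwise.}\end{cases}$$ For $i\in\{1,\dots,\mathsf v\}$, $\mathcal N_i$ is the set of indices $j$, including $i$ itself, such that $v_j$ shares a facet with $v_i$ in the given configuration (i.e. $i,j\in F_k$ for some $k$). With $v=(v_1,\dots,v_{\mathsf v})$, $u=(u_1,\dots,u_{\mathsf v})$, $$\mathcal E_i=\left\{e\in\mathbb R^{n_{\mathrm x}}\ \middle|\ \|e\|_\infty\le\gamma\cdot\max_{j,k\in\mathcal N_i}\left\|\begin{bmatrix}v_j-v_k\\ u_j-u_k\end{bmatrix}\right\|^\alpha\right\},\qquad \kappa_i=\sigma\cdot\max_{j,k\in\mathcal N_i}\left\|\begin{bmatrix}v_j-v_k\\ u_j-u_k\end{bmatrix}\right\|^\beta,$$ and $\mathbb D_i=\mathcal E_i+\mathbb W$ (Minkowski sum). *)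

theory Defs
  imports "HOL-Analysis.Analysis"
begin

text \<open>The block vector with blocks \<open>x\<close> and \<open>u\<close> is the pair \<open>(x, u)\<close>.\<close>

definition is_norm :: "('a::real_vector \<Rightarrow> real) \<Rightarrow> bool" where
  "is_norm N \<longleftrightarrow>
     (\<forall>x. N x = 0 \<longleftrightarrow> x = 0) \<and>
     (\<forall>c x. N (c *\<^sub>R x) = \<bar>c\<bar> * N x) \<and>
     (\<forall>x y. N (x + y) \<le> N x + N y)"

text \<open>Real powers of non-negative numbers with \<open>0\<^sup>0 = 1\<close>; the library has \<open>0 powr 0 = 0\<close>.\<close>

definition rpow :: "real \<Rightarrow> real \<Rightarrow> real" where
  "rpow r a = (if a = 0 then 1 else r powr a)"

definition max_dist_pow ::
  "('a::real_vector \<times> 'b::real_vector \<Rightarrow> real) \<Rightarrow> real \<Rightarrow> 'i set \<Rightarrow> ('i \<Rightarrow> 'a) \<Rightarrow> ('i \<Rightarrow> 'b) \<Rightarrow> real" where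
  "max_dist_pow N a I v u = Max ((\<lambda>(j, k). rpow (N (v j - v k, u j - u k)) a) ` (I \<times> I))"

definition unit_simplex :: "nat \<Rightarrow> (nat \<Rightarrow> real) set" where
  "unit_simplex n = {\<theta>. (\<forall>i\<in>{1..n}. 0 \<le> \<theta> i) \<and> (\<Sum>i=1..n. \<theta> i) = 1}"

text \<open>In the next two definitions, an upper bound on the maximum over the simplex is written as a
  bound for all of its elements.\<close>

definition assumption_F ::
  "((real^'nx) \<times> (real^'nu) \<Rightarrow> real) \<Rightarrow> (real^'nx) set \<Rightarrow> (real^'nu) set \<Rightarrow>
   ((real^'nx) \<times> (real^'nu) \<Rightarrow> real^'nx) \<Rightarrow> real \<Rightarrow> real \<Rightarrow> bool" where
  "assumption_F N X U f \<gamma> \<alpha> \<longleftrightarrow>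
     (let n = CARD('nx) + 1 in
      \<forall>v u. (\<forall>i\<in>{1..n}. v i \<in> X) \<longrightarrow> (\<forall>i\<in>{1..n}. u i \<in> U) \<longrightarrow>
        (\<forall>\<theta>\<in>unit_simplex n.
           infnorm ((\<Sum>i=1..n. \<theta> i *\<^sub>R f (v i, u i))
                    - f (\<Sum>i=1..n. \<theta> i *\<^sub>R v i, \<Sum>i=1..n. \<theta> i *\<^sub>R u i))
           \<le> \<gamma> * max_dist_pow N \<alpha> {1..n} v u))"

definition assumption_L ::
  "((real^'nx) \<times> (real^'nu) \<Rightarrow> real) \<Rightarrow> (real^'nx) set \<Rightarrow> (real^'nu) set \<Rightarrow>
   ((real^'nx) \<times> (real^'nu) \<Rightarrow> real) \<Rightarrow> real \<Rightarrow> real \<Rightarrow> bool" where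
  "assumption_L N X U L \<sigma> \<beta> \<longleftrightarrow>
     (let n = CARD('nx) + 1 in
      \<forall>v u. (\<forall>i\<in>{1..n}. v i \<in> X) \<longrightarrow> (\<forall>i\<in>{1..n}. u i \<in> U) \<longrightarrow>
        (\<forall>\<theta>\<in>unit_simplex n.
           L (\<Sum>i=1..n. \<theta> i *\<^sub>R v i, \<Sum>i=1..n. \<theta> i *\<^sub>R u i) - (\<Sum>i=1..n. \<theta> i * L (v i, u i))
           \<le> \<sigma> * max_dist_pow N \<beta> {1..n} v u))"

text \<open>The rows of \<open>(z\<^sub>1, z\<^sub>2)\<close> are indexed by the disjoint sum \<open>'f1 + 'f2\<close>, so that
  \<open>z\<^sub>1 $ i\<close> is \<open>z $ Inl i\<close> and \<open>z\<^sub>2 $ i\<close> is \<open>z $ Inr i\<close>.\<close>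

definition cfg_poly ::
  "real^'nx^'f1 \<Rightarrow> real^'nx^'f2 \<Rightarrow> real^'f2 \<Rightarrow> real^('f1::finite + 'f2::finite) \<Rightarrow> ((real^'nx) \<times> real) set" where
  "cfg_poly G1 G2 h2 z =
     {(x, y). (\<forall>i. (G1 *v x) $ i \<le> z $ Inl i) \<and> (\<forall>i. (G2 *v x) $ i + h2 $ i * y \<le> z $ Inr i)}"

definition cfg_face ::
  "real^'nx^'f1 \<Rightarrow> real^'nx^'f2 \<Rightarrow> real^'f2 \<Rightarrow> real^('f1::finite + 'f2::finite) \<Rightarrow> 'f1 + 'f2 \<Rightarrow>
   ((real^'nx) \<times> real) set" where
  "cfg_face G1 G2 h2 z k =
     {(x, y) \<in> cfg_poly G1 G2 h2 z.
        case k of Inl i \<Rightarrow> (G1 *v x) $ i = z $ Inl i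
                | Inr i \<Rightarrow> (G2 *v x) $ i + h2 $ i * y = z $ Inr i}"

definition up_ray :: "((real^'nx) \<times> real) set" where
  "up_ray = (\<lambda>t. t *\<^sub>R (0, 1)) ` {0..}"

definition cfg_vertex ::
  "('v \<Rightarrow> real^('f1::finite + 'f2::finite)^'nx) \<Rightarrow> ('v \<Rightarrow> real^('f1::finite + 'f2::finite)) \<Rightarrow> real^('f1::finite + 'f2::finite) \<Rightarrow> 'v \<Rightarrow>
   (real^'nx) \<times> real" where
  "cfg_vertex V s z i = (V i *v z, s i \<bullet> z)"

text \<open>\<open>Fc k\<close> is the set of (indices of) vertices on the \<open>k\<close>-th facet. Sums of sets are Minkowski
  sums.\<close>

definition configuration_template ::
  "real^'nx^'f1 \<Rightarrow> real^'nx^'f2 \<Rightarrow> real^'f2 \<Rightarrow> ('v::finite \<Rightarrow> real^('f1::finite + 'f2::finite)^'nx) \<Rightarrow>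
   ('v \<Rightarrow> real^('f1::finite + 'f2::finite)) \<Rightarrow> real^('f1::finite + 'f2::finite)^'e \<Rightarrow> ('f1 + 'f2 \<Rightarrow> 'v set) \<Rightarrow> bool" where
  "configuration_template G1 G2 h2 V s E Fc \<longleftrightarrow>
     (\<forall>i. h2 $ i < 0) \<and>
     (\<forall>x. G1 *v x \<le> 0 \<longrightarrow> x = 0) \<and>
     (\<forall>z. E *v z \<le> 0 \<longleftrightarrow>
          cfg_poly G1 G2 h2 z = convex hull (range (cfg_vertex V s z)) + up_ray) \<and>
     (\<forall>z. E *v z \<le> 0 \<longrightarrow>
          (\<forall>i. cfg_face G1 G2 h2 z (Inl i)
                = convex hull (cfg_vertex V s z ` Fc (Inl i)) + up_ray) \<and>
          (\<forall>i. cfg_face G1 G2 h2 z (Inr i) = convex hull (cfg_vertex V s z ` Fc (Inr i))))"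

definition M_fun ::
  "real^'nx^'f1 \<Rightarrow> real^'nx^'f2 \<Rightarrow> real^'f2 \<Rightarrow> real^('f1::finite + 'f2::finite) \<Rightarrow> real^'nx \<Rightarrow> ereal" where
  "M_fun G1 G2 h2 z x =
     (if \<forall>i. (G1 *v x) $ i \<le> z $ Inl i
      then ereal (MAX i. (z $ Inr i - (G2 *v x) $ i) / h2 $ i)
      else \<infinity>)"

definition ind_fun :: "'a set \<Rightarrow> 'a \<Rightarrow> ereal" where
  "ind_fun X x = (if x \<in> X then 0 else \<infinity>)"

definition nbrs :: "('k \<Rightarrow> 'v set) \<Rightarrow> 'v \<Rightarrow> 'v set" where
  "nbrs Fc i = insert i {j. \<exists>k. i \<in> Fc k \<and> j \<in> Fc k}"

definition err_set ::
  "((real^'nx) \<times> (real^'nu) \<Rightarrow> real) \<Rightarrow> real \<Rightarrow> real \<Rightarrow> ('k \<Rightarrow> 'v set) \<Rightarrow>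
   ('v \<Rightarrow> real^'nx) \<Rightarrow> ('v \<Rightarrow> real^'nu) \<Rightarrow> 'v \<Rightarrow> (real^'nx) set" where
  "err_set N \<gamma> \<alpha> Fc v u i = {e. infnorm e \<le> \<gamma> * max_dist_pow N \<alpha> (nbrs Fc i) v u}"

definition kappa ::
  "((real^'nx) \<times> (real^'nu) \<Rightarrow> real) \<Rightarrow> real \<Rightarrow> real \<Rightarrow> ('k \<Rightarrow> 'v set) \<Rightarrow>
   ('v \<Rightarrow> real^'nx) \<Rightarrow> ('v \<Rightarrow> real^'nu) \<Rightarrow> 'v \<Rightarrow> real" where
  "kappa N \<sigma> \<beta> Fc v u i = \<sigma> * max_dist_pow N \<beta> (nbrs Fc i) v u"

text \<open>\<open>L\<close> is a total function that is only meaningful on \<open>X \<times> U\<close>. For \<open>x \<notin> X\<close> the stage value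
  \<open>ereal (L (x, u)) + ind_fun X x + c\<close> is \<open>\<infinity>\<close> whatever \<open>L (x, u)\<close> is, as \<open>M_fun\<close> is never
  \<open>-\<infinity>\<close>. Minima and maxima in the extended reals are infima and suprema that are attained.\<close>

definition is_minimum_over :: "('a \<Rightarrow> ereal) \<Rightarrow> 'a set \<Rightarrow> ereal \<Rightarrow> bool" where
  "is_minimum_over g A m \<longleftrightarrow> m = (INF a\<in>A. g a) \<and> m \<in> g ` A"

definition is_maximum_over :: "('a \<Rightarrow> ereal) \<Rightarrow> 'a set \<Rightarrow> ereal \<Rightarrow> bool" where
  "is_maximum_over g A m \<longleftrightarrow> m = (SUP a\<in>A. g a) \<and> m \<in> g ` A"

end

theory Submission
  imports Defs
begin

text \<open>If \<open>M x\<close> is finite, then \<open>(x, M x)\<close> lies on a facet of the epigraph whose inequality involves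
  the last coordinate. This facet is the convex hull of its vertices and spans at most a hyperplane
  of \<open>\<real>\<^sup>n\<close>, so Caratheodory's theorem writes \<open>(x, M x)\<close> as a convex combination of only \<open>n\<close> of
  these vertices, the number that Assumptions (F) and (L) permit. All of them are neighbours of each
  other; applying the same convex combination to the inputs \<open>u\<^sub>i\<close> gives an input for \<open>x\<close> whose
  interpolation errors are covered by each of the \<open>\<E>\<^sub>i\<close> and \<open>\<kappa>\<^sub>i\<close> involved, and convexity of the
  epigraph transfers the vertex inequalities to \<open>x\<close>.\<close>

section \<open>General facts on attained minima and convex combinations\<close>

lemma continuous_on_MAX:
  fixes g :: "'i \<Rightarrow> 'a::topological_space \<Rightarrow> real"
  assumes "finite I" "I \<noteq> {}" "\<And>i. i \<in> I \<Longrightarrow> continuous_on S (g i)"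
  shows "continuous_on S (\<lambda>x. MAX i\<in>I. g i x)"
  using assms
proof (induction I rule: finite_ne_induct)
  case (insert i I)
  then have "(\<lambda>x. MAX j\<in>insert i I. g j x) = (\<lambda>x. max (g i x) (MAX j\<in>I. g j x))"
    by simp
  with insert show ?case
    by (auto intro!: continuous_on_max)
qed simp

text \<open>The sublevel sets at the values of \<open>g\<close> form a chain of nonempty compact
  sets, so they have a common point; it is a minimizer.\<close>

lemma lower_semicontinuous_attains_minimum:
  fixes g :: "'a::heine_borel \<Rightarrow> ereal"
  assumes "compact U" "U \<noteq> {}" "\<And>c. closed {a\<in>U. g a \<le> c}"
  shows "\<exists>m. is_minimum_over g U m"
proof -
  let ?S = "\<lambda>b. {a\<in>U. g a \<le> g b}"
  have "\<Inter>(?S ` U) \<noteq> {}"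
  proof (rule compact_chain)
    show "compact A" if "A \<in> ?S ` U" for A
    proof -
      from that have "closed A" "U \<inter> A = A"
        using assms(3) by auto
      then show ?thesis
        using compact_Int_closed[OF assms(1)] by metis
    qed
    show "A \<subseteq> B \<or> B \<subseteq> A" if "A \<in> ?S ` U \<and> B \<in> ?S ` U" for A B
    proof -
      from that obtain a b where "A = ?S a" "B = ?S b" by blast
      then show ?thesis by (cases "g a \<le> g b") auto
    qed
  qed auto
  then obtain a where "\<forall>b\<in>U. a \<in> ?S b" by auto
  then have "a \<in> U" "\<And>b. b \<in> U \<Longrightarrow> g a \<le> g b"
    using \<open>U \<noteq> {}\<close> by auto
  then have "is_minimum_over g U (g a)"
    unfolding is_minimum_over_def by (auto intro!: antisym INF_greatest INF_lower)
  then show ?thesis ..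
qed

text \<open>Caratheodory's theorem gives a set of at most \<open>n\<close> points, whereas both
  interpolation assumptions speak of tuples of length exactly \<open>n\<close>. The tuple consists
  of indices rather than points because the inputs are attached to indices and \<open>c\<close> need
  not be injective.\<close>

lemma caratheodory_indexed:
  fixes c :: "'v \<Rightarrow> 'a::euclidean_space"
  assumes x: "x \<in> convex hull (c ` F)" and dim: "aff_dim (c ` F) + 1 \<le> int n"
  obtains j \<theta> where "\<And>i. i \<in> {1..n} \<Longrightarrow> j i \<in> F" "\<theta> \<in> unit_simplex n"
    "(\<Sum>i=1..n. \<theta> i *\<^sub>R c (j i)) = x"
proof -
  from x obtain S w where S: "finite S" "S \<subseteq> c ` F" "int (card S) \<le> aff_dim (c ` F) + 1"
    and w: "\<forall>y\<in>S. 0 \<le> w y" "sum w S = 1" "(\<Sum>y\<in>S. w y *\<^sub>R y) = x"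
    unfolding convex_hull_caratheodory_aff_dim by blast
  from S(3) dim have "card S \<le> n" by linarith
  obtain h where h: "bij_betw h {1..card S} S"
    using ex_bij_betw_nat_finite_1[OF S(1)] by blast
  from w(2) obtain y0 where "y0 \<in> S" by fastforce
  \<comment> \<open>Positions beyond \<open>card S\<close> repeat the point \<open>y0\<close> with
    weight zero, which pads the combination to \<open>n\<close> terms.\<close>
  define j where "j i = inv_into F c (if i \<le> card S then h i else y0)" for i
  define \<theta> where "\<theta> i = (if i \<le> card S then w (h i) else 0)" for i
  have hS: "h i \<in> S" if "i \<in> {1..card S}" for i
    using bij_betwE[OF h] that by blast
  have jF: "j i \<in> F" if "i \<in> {1..n}" for i
    unfolding j_def using hS[of i] that \<open>y0 \<in> S\<close> S(2) by (auto intro!: inv_into_into)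
  have cj: "c (j i) = h i" if "i \<in> {1..card S}" for i
    unfolding j_def using hS[OF that] that S(2) by (auto simp: f_inv_into_f subset_iff)
  have restrict: "(\<Sum>i=1..n. G i) = (\<Sum>i=1..card S. G i)"
    if "\<And>i. \<not> i \<le> card S \<Longrightarrow> G i = 0" for G :: "nat \<Rightarrow> 'z::comm_monoid_add"
    using \<open>card S \<le> n\<close> that by (intro sum.mono_neutral_right) auto
  have "(\<Sum>i=1..n. \<theta> i) = (\<Sum>i=1..card S. w (h i))"
    by (subst restrict) (auto simp: \<theta>_def)
  also have "\<dots> = 1"
    using sum.reindex_bij_betw[OF h, of w] w(2) by simp
  finally have "\<theta> \<in> unit_simplex n"
    using w(1) hS by (auto simp: unit_simplex_def \<theta>_def)
  moreover have "(\<Sum>i=1..n. \<theta> i *\<^sub>R c (j i)) = (\<Sum>i=1..card S. w (h i) *\<^sub>R h i)"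
    by (subst restrict) (auto simp: \<theta>_def cj)
  then have "(\<Sum>i=1..n. \<theta> i *\<^sub>R c (j i)) = x"
    using sum.reindex_bij_betw[OF h, of "\<lambda>y. w y *\<^sub>R y"] w(3) by simp
  ultimately show thesis
    using that jF by blast
qed

section \<open>Powers of pairwise distances\<close>

lemma rpow_nonneg: "0 \<le> rpow r a"
  by (simp add: rpow_def)

lemma max_dist_pow_nonneg:
  assumes "finite I" "I \<noteq> {}"
  shows "0 \<le> max_dist_pow N a I v u"
proof -
  from assms(2) obtain i where "i \<in> I" by blast
  then have "rpow (N (v i - v i, u i - u i)) a \<le> max_dist_pow N a I v u"
    unfolding max_dist_pow_def using assms(1) by (intro Max_ge) force+
  then show ?thesis
    using rpow_nonneg order_trans by blast
qed

text \<open>Compares the numbered tuples of the interpolation assumptions, where a vertex may be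
  repeated, with neighbourhoods of vertices.\<close>

lemma max_dist_pow_reindex_le:
  assumes "finite J" "I \<noteq> {}" "j ` I \<subseteq> J"
  shows "max_dist_pow N a I (\<lambda>i. v (j i)) (\<lambda>i. u (j i)) \<le> max_dist_pow N a J v u"
  unfolding max_dist_pow_def using assms by (intro Max_mono) force+

section \<open>The polyhedron as an epigraph, and its facets\<close>

lemma M_fun_le_iff:
  assumes "\<And>i. h2 $ i < 0"
  shows "M_fun G1 G2 h2 z x \<le> ereal t \<longleftrightarrow> (x, t) \<in> cfg_poly G1 G2 h2 z"
proof -
  have "(z $ Inr i - (G2 *v x) $ i) / h2 $ i \<le> t \<longleftrightarrow> (G2 *v x) $ i + h2 $ i * t \<le> z $ Inr i" for i
    using assms[of i] by (simp add: neg_divide_le_eq algebra_simps)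
  then show ?thesis
    by (simp add: M_fun_def cfg_poly_def)
qed

lemma M_fun_not_MInfty: "M_fun G1 G2 h2 z x \<noteq> -\<infinity>"
  by (simp add: M_fun_def)

text \<open>A maximum over finitely many rows is attained, and the attaining row is active at
  \<open>(x, t)\<close>.\<close>

lemma M_fun_on_facet:
  assumes "\<And>i. h2 $ i < 0" "M_fun G1 G2 h2 z x = ereal t"
  obtains k where "(x, t) \<in> cfg_face G1 G2 h2 z (Inr k)"
proof -
  from assms(2) have "t = (MAX i. (z $ Inr i - (G2 *v x) $ i) / h2 $ i)"
    by (auto simp: M_fun_def split: if_splits)
  also have "\<dots> \<in> range (\<lambda>i. (z $ Inr i - (G2 *v x) $ i) / h2 $ i)"
    by (intro Max_in) auto
  finally obtain k where "t = (z $ Inr k - (G2 *v x) $ k) / h2 $ k" by blast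
  then have "(G2 *v x) $ k + h2 $ k * t = z $ Inr k"
    using assms(1)[of k] by simp
  moreover have "(x, t) \<in> cfg_poly G1 G2 h2 z"
    using M_fun_le_iff[OF assms(1)] assms(2) by (metis order_refl)
  ultimately show thesis
    by (intro that) (simp add: cfg_face_def)
qed

lemma matrix_vector_mult_component_inner:
  fixes A :: "real^'n^'m"
  shows "(A *v x) $ i = A $ i \<bullet> x"
  by (simp add: matrix_vector_mult_def inner_vec_def)

lemma cfg_poly_eq_halfspaces:
  "cfg_poly G1 G2 h2 z = (\<Inter>i. {p. (G1 $ i, 0) \<bullet> p \<le> z $ Inl i}) \<inter>
     (\<Inter>i. {p. (G2 $ i, h2 $ i) \<bullet> p \<le> z $ Inr i})"
  by (auto simp: cfg_poly_def matrix_vector_mult_component_inner)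

lemma convex_cfg_poly: "convex (cfg_poly G1 G2 h2 z)"
  unfolding cfg_poly_eq_halfspaces by (intro convex_Int convex_INT) (auto intro: convex_halfspace_le)

lemma closed_cfg_poly: "closed (cfg_poly G1 G2 h2 z)"
  unfolding cfg_poly_eq_halfspaces by (intro closed_Int closed_INT) (auto intro: closed_halfspace_le)

text \<open>As \<open>h2 $ k < 0\<close>, the normal of the active row is nonzero, so the face lies
  in a hyperplane. This saves one point in Caratheodory's theorem.\<close>

lemma aff_dim_cfg_face_Inr:
  fixes G1 :: "real^'nx^'f1" and G2 :: "real^'nx^'f2"
  assumes "h2 $ k < 0" "S \<subseteq> cfg_face G1 G2 h2 z (Inr k)"
  shows "aff_dim S \<le> CARD('nx)"
proof -
  have "S \<subseteq> {p. (G2 $ k, h2 $ k) \<bullet> p = z $ Inr k}"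
    using assms(2) by (auto simp: cfg_face_def matrix_vector_mult_component_inner)
  then have "aff_dim S \<le> aff_dim {p. (G2 $ k, h2 $ k) \<bullet> p = z $ Inr k}"
    by (rule aff_dim_subset)
  also have "\<dots> = CARD('nx)"
    using assms(1) by (subst aff_dim_hyperplane) (auto simp: zero_prod_def)
  finally show ?thesis .
qed

section \<open>Attainment of the maximum and closedness of sublevel sets for the stage cost\<close>

lemma stage_max_attained:
  assumes "W \<noteq> {}" "compact W"
  shows "\<exists>g. is_maximum_over (\<lambda>w. ereal l + ind_fun X x + M_fun G1 G2 h2 z (y + w)) W g"
proof -
  let ?M = "M_fun G1 G2 h2 z"
  let ?G = "\<lambda>w. ereal l + ind_fun X x + ?M (y + w)"
  have "\<exists>w0\<in>W. \<forall>w\<in>W. ?G w \<le> ?G w0"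
  \<comment> \<open>\<open>M_fun\<close> jumps to infinity at the border of its domain, so
    continuity helps only if all values are finite; otherwise an infinite value is itself the
    maximum.\<close>
  proof (cases "x \<in> X \<and> (\<forall>w\<in>W. ?M (y + w) \<noteq> \<infinity>)")
    case True
    define m where "m y = (MAX i. (z $ Inr i - (G2 *v y) $ i) / h2 $ i)" for y
    have "continuous_on W (\<lambda>w. m (y + w))"
      unfolding m_def matrix_vector_mult_component_inner divide_inverse
      by (intro continuous_on_MAX) (auto intro!: continuous_intros)
    then obtain w0 where "w0 \<in> W" "\<forall>w\<in>W. m (y + w) \<le> m (y + w0)"
      using continuous_attains_sup[OF assms(2,1)] by blast
    moreover have "?M (y + w) = ereal (m (y + w))" if "w \<in> W" for w
      using True that by (auto simp: M_fun_def m_def split: if_splits)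
    ultimately show ?thesis
      using True by (auto simp: ind_fun_def intro!: bexI[of _ w0])
  next
    case False
    then obtain w0 where "w0 \<in> W" "?G w0 = \<infinity>"
    proof (cases "x \<in> X")
      case True
      with False obtain w0 where "w0 \<in> W" "?M (y + w0) = \<infinity>" by blast
      then show thesis using True by (intro that) (auto simp: ind_fun_def)
    next
      case False
      obtain w0 where "w0 \<in> W" using assms(1) by blast
      then show thesis using False by (intro that) (simp_all add: ind_fun_def)
    qed
    then show ?thesis by (metis ereal_less_eq(1))
  qed
  then obtain w0 where "w0 \<in> W" "\<forall>w\<in>W. ?G w \<le> ?G w0" by blast
  then have "is_maximum_over ?G W (?G w0)"
    unfolding is_maximum_over_def by (auto intro!: antisym SUP_least SUP_upper)
  then show ?thesis ..
qed

text \<open>For \<open>x\<close> in \<open>X\<close> and a real level \<open>r\<close>, moving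
  \<open>L\<close> to the right-hand side makes the sublevel set the preimage of the closed epigraph
  under the continuous map from \<open>a\<close> to
  \<open>(f (x, a) + w, r - L (x, a))\<close>.\<close>

lemma closed_stage_sublevel:
  fixes f :: "(real^'nx) \<times> (real^'nu) \<Rightarrow> real^'nx"
  assumes h2: "\<And>i. h2 $ i < 0" and "closed U" "continuous_on UNIV f" "continuous_on (X \<times> U) L"
  shows "closed {a\<in>U. ereal (L (x, a)) + ind_fun X x + M_fun G1 G2 h2 z (f (x, a) + w) \<le> c}"
    (is "closed {a\<in>U. ?G a \<le> c}")
proof (cases "x \<in> X")
  case False
  then have "{a\<in>U. ?G a \<le> c} = (if c = \<infinity> then U else {})"
    by (auto simp: ind_fun_def)
  then show ?thesis
    using \<open>closed U\<close> by simp
next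
  case True
  have G: "?G a = ereal (L (x, a)) + M_fun G1 G2 h2 z (f (x, a) + w)" for a
    using True by (simp add: ind_fun_def)
  show ?thesis
  proof (cases c)
    case (real r)
    have cont: "continuous_on U (\<lambda>a. (f (x, a) + w, r - L (x, a)))"
      using True
      by (intro continuous_intros continuous_on_compose2[OF assms(3)] continuous_on_compose2[OF assms(4)]) auto
    have "?G a \<le> c \<longleftrightarrow> (f (x, a) + w, r - L (x, a)) \<in> cfg_poly G1 G2 h2 z" for a
      unfolding G real M_fun_le_iff[OF h2, symmetric]
      by (cases "M_fun G1 G2 h2 z (f (x, a) + w)") auto
    then have "{a\<in>U. ?G a \<le> c} =
        U \<inter> (\<lambda>a. (f (x, a) + w, r - L (x, a))) -` cfg_poly G1 G2 h2 z"
      by auto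
    then show ?thesis
      using continuous_closed_preimage[OF cont \<open>closed U\<close> closed_cfg_poly] by simp
  next
    case PInf
    then show ?thesis using \<open>closed U\<close> by simp
  next
    case MInf
    then have "{a\<in>U. ?G a \<le> c} = {}"
      by (auto simp: G M_fun_not_MInfty)
    then show ?thesis by (metis closed_empty)
  qed
qed

section \<open>Transfer of the inequality from the vertices to all states\<close>

theorem theorem1:
  fixes N :: "(real^'nx) \<times> (real^'nu) \<Rightarrow> real"
    and X W :: "(real^'nx) set" and U :: "(real^'nu) set"
    and f :: "(real^'nx) \<times> (real^'nu) \<Rightarrow> real^'nx"
    and L :: "(real^'nx) \<times> (real^'nu) \<Rightarrow> real"
    and \<gamma> \<alpha> \<sigma> \<beta> d :: real
    and G1 :: "real^'nx^'f1" and G2 :: "real^'nx^'f2" and h2 :: "real^'f2"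
    and V :: "'v::finite \<Rightarrow> real^('f1 + 'f2)^'nx" and s :: "'v \<Rightarrow> real^('f1 + 'f2)"
    and E :: "real^('f1 + 'f2)^'e" and Fc :: "'f1 + 'f2 \<Rightarrow> 'v set"
    and z :: "real^('f1 + 'f2)"
    and v :: "'v \<Rightarrow> real^'nx" and u :: "'v \<Rightarrow> real^'nu"
    and M :: "real^'nx \<Rightarrow> ereal" and D :: "'v \<Rightarrow> (real^'nx) set" and \<kappa> :: "'v \<Rightarrow> real"
  assumes "is_norm N"
    and "convex X" "closed X"
    and "U \<noteq> {}" "convex U" "compact U"
    and "W \<noteq> {}" "convex W" "compact W"
    and "\<exists>C. C-lipschitz_on UNIV f"
    and "0 \<le> \<gamma>" "0 \<le> \<alpha>" "assumption_F N X U f \<gamma> \<alpha>"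
    and "\<forall>x\<in>X. \<forall>y\<in>U. 0 \<le> L (x, y)"
    and "\<exists>C. C-lipschitz_on (X \<times> U) L"
    and "0 \<le> \<sigma>" "1 \<le> \<beta>" "assumption_L N X U L \<sigma> \<beta>"
    and "configuration_template G1 G2 h2 V s E Fc"
    and "E *v z \<le> 0"
    and M_eq: "M = M_fun G1 G2 h2 z"
    and v_eq: "\<And>i. v i = V i *v z"
    and "\<And>i. u i \<in> U"
    and D_eq: "\<And>i. D i = err_set N \<gamma> \<alpha> Fc v u i + W"
    and kappa_eq: "\<And>i. \<kappa> i = kappa N \<sigma> \<beta> Fc v u i"
    and vertex_ineq: "\<And>i. M (v i) + ereal d \<ge>
           (SUP \<delta>\<in>D i. ereal (L (v i, u i)) + ereal (\<kappa> i) + ind_fun X (v i) + M (f (v i, u i) + \<delta>))"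
  shows "\<forall>x. \<exists>g m.
           (\<forall>a\<in>U. is_maximum_over (\<lambda>w. ereal (L (x, a)) + ind_fun X x + M (f (x, a) + w)) W (g a)) \<and>
           is_minimum_over g U m \<and>
           M x + ereal d \<ge> m"
proof
  fix x
  note U = assms(4-6) and W = assms(7-9) and F = assms(13) and LL = assms(18)
    and tmpl = assms(19)
  define G where "G a w = ereal (L (x, a)) + ind_fun X x + M (f (x, a) + w)" for a w
  have h2: "h2 $ i < 0" for i
    using tmpl by (simp add: configuration_template_def)
  have M_le: "M y \<le> ereal t \<longleftrightarrow> (y, t) \<in> cfg_poly G1 G2 h2 z" for y t
    unfolding M_eq by (rule M_fun_le_iff) (rule h2)
  have M_ninf: "M y \<noteq> -\<infinity>" for y
    unfolding M_eq by (rule M_fun_not_MInfty)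
  have "\<forall>a. \<exists>t. is_maximum_over (G a) W t"
    unfolding G_def M_eq using W(1,3) by (auto intro: stage_max_attained)
  then obtain g where g: "\<And>a. is_maximum_over (G a) W (g a)" by metis
  have g_le: "g a \<le> c \<longleftrightarrow> (\<forall>w\<in>W. G a w \<le> c)" for a c
    using g[of a] by (simp add: is_maximum_over_def SUP_le_iff)
  have closed_G: "closed {a\<in>U. G a w \<le> c}" for w c
    unfolding G_def M_eq using assms(10,15)
    by (intro closed_stage_sublevel h2 compact_imp_closed U(3)) (auto dest: lipschitz_on_continuous_on)
  \<comment> \<open>A supremum of lower semicontinuous functions is lower semicontinuous. Since
    \<open>W\<close> is nonempty, the intersection stays inside \<open>U\<close>.\<close>
  have "{a\<in>U. g a \<le> c} = (\<Inter>w\<in>W. {a\<in>U. G a w \<le> c})" for c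
    using W(1) by (auto simp: g_le)
  then have "closed {a\<in>U. g a \<le> c}" for c
    using closed_G by (simp add: closed_INT)
  then obtain m where m: "is_minimum_over g U m"
    using lower_semicontinuous_attains_minimum[OF U(3,1)] by blast
  have "m \<le> M x + ereal d"
  proof (cases "M x")
    case PInf
    then show ?thesis by simp
  next
    case MInf
    then show ?thesis using M_ninf by simp
  next
    case (real t)
    obtain k where k: "(x, t) \<in> cfg_face G1 G2 h2 z (Inr k)"
      using M_fun_on_facet[OF h2] real unfolding M_eq by blast
    let ?c = "cfg_vertex V s z" and ?F = "Fc (Inr k)" and ?n = "CARD('nx) + 1"
    have face: "cfg_face G1 G2 h2 z (Inr k) = convex hull (?c ` ?F)"
      using tmpl \<open>E *v z \<le> 0\<close> by (simp add: configuration_template_def)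
    then have c_face: "?c ` ?F \<subseteq> cfg_face G1 G2 h2 z (Inr k)"
      by (simp add: hull_subset)
    have "aff_dim (?c ` ?F) + 1 \<le> int ?n"
      using aff_dim_cfg_face_Inr[OF h2 c_face] by simp
    then obtain j \<theta> where j: "\<And>i. i \<in> {1..?n} \<Longrightarrow> j i \<in> ?F" and \<theta>: "\<theta> \<in> unit_simplex ?n"
      and xt: "(\<Sum>i=1..?n. \<theta> i *\<^sub>R ?c (j i)) = (x, t)"
      using caratheodory_indexed k[unfolded face] by blast
    have \<theta>_nonneg: "\<And>i. i \<in> {1..?n} \<Longrightarrow> 0 \<le> \<theta> i" and \<theta>_sum: "(\<Sum>i=1..?n. \<theta> i) = 1"
      using \<theta> by (auto simp: unit_simplex_def)
    let ?v = "\<lambda>i. v (j i)" and ?u = "\<lambda>i. u (j i)" and ?t = "\<lambda>i. s (j i) \<bullet> z"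
    define a where "a = (\<Sum>i=1..?n. \<theta> i *\<^sub>R ?u i)"
    \<comment> \<open>The interpolation error of \<open>f\<close>; adding it to the averaged
      successors gives exactly \<open>f (x, a)\<close>.\<close>
    define e where "e = f (x, a) - (\<Sum>i=1..?n. \<theta> i *\<^sub>R f (?v i, ?u i))"
    have x_eq: "x = (\<Sum>i=1..?n. \<theta> i *\<^sub>R ?v i)" and t_eq: "t = (\<Sum>i=1..?n. \<theta> i * ?t i)"
      using arg_cong[OF xt, of fst] arg_cong[OF xt, of snd]
      by (simp_all add: fst_sum snd_sum cfg_vertex_def v_eq)
    have "a \<in> U"
      unfolding a_def using U(2) \<theta>_nonneg \<theta>_sum assms(23) by (intro convex_sum) auto
    \<comment> \<open>An upper bound suffices, as \<open>M (v i)\<close> occurs only on the larger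
      side of the vertex inequality.\<close>
    have Mv: "M (?v i) \<le> ereal (?t i)" if "i \<in> {1..?n}" for i
    proof -
      have "?c (j i) \<in> cfg_face G1 G2 h2 z (Inr k)"
        using c_face j[OF that] by blast
      then show ?thesis
        by (auto simp: M_le cfg_face_def cfg_vertex_def v_eq)
    qed
    have nbr: "j ` {1..?n} \<subseteq> nbrs Fc (j i)" if "i \<in> {1..?n}" for i
      using j j[OF that] unfolding nbrs_def by blast
    have dist_le: "max_dist_pow N b {1..?n} ?v ?u \<le> max_dist_pow N b (nbrs Fc (j i)) v u"
      if "i \<in> {1..?n}" for i b
      using nbr[OF that] by (intro max_dist_pow_reindex_le) auto
    have vertex: "ereal (L (v i, u i)) + ereal (\<kappa> i) + ind_fun X (v i) + M (f (v i, u i) + \<delta>)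
        \<le> M (v i) + ereal d" if "\<delta> \<in> D i" for i \<delta>
      using vertex_ineq[of i] that by (simp add: SUP_le_iff)
    \<comment> \<open>Outside \<open>X\<close> the smaller side of the vertex inequality would be
      infinite and the larger side finite. The argument needs an element of \<open>D (j i)\<close>,
      obtained from a zero error and any \<open>w\<close> in \<open>W\<close>.\<close>
    have vX: "?v i \<in> X" if "i \<in> {1..?n}" for i
    proof (rule ccontr)
      assume "?v i \<notin> X"
      obtain w where "w \<in> W" using W(1) by blast
      moreover have "0 \<in> err_set N \<gamma> \<alpha> Fc v u (j i)"
        using \<open>0 \<le> \<gamma>\<close> by (simp add: err_set_def nbrs_def infnorm_0 max_dist_pow_nonneg)
      ultimately have "w \<in> D (j i)"
        unfolding D_eq by (metis add_0 set_plus_intro)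
      from vertex[OF this] \<open>?v i \<notin> X\<close> Mv[OF that] M_ninf show False
        by (auto simp: ind_fun_def)
    qed
    have "x \<in> X"
      unfolding x_eq using \<open>convex X\<close> \<theta>_nonneg \<theta>_sum vX by (intro convex_sum) auto
    \<comment> \<open>The single error \<open>e\<close> is admissible at every chosen vertex, so the
      same disturbance \<open>e + w\<close> can be used in all their inequalities.\<close>
    have e_in: "e \<in> err_set N \<gamma> \<alpha> Fc v u (j i)" if "i \<in> {1..?n}" for i
    proof -
      have "infnorm ((\<Sum>i=1..?n. \<theta> i *\<^sub>R f (?v i, ?u i)) - f (x, a)) \<le> \<gamma> * max_dist_pow N \<alpha> {1..?n} ?v ?u"
        unfolding x_eq a_def
        using F[unfolded assumption_F_def Let_def, rule_format, of ?v ?u \<theta>] vX assms(23) \<theta> by blast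
      also have "\<dots> \<le> \<gamma> * max_dist_pow N \<alpha> (nbrs Fc (j i)) v u"
        using dist_le[OF that] \<open>0 \<le> \<gamma>\<close> by (rule mult_left_mono)
      finally show ?thesis
        by (simp add: err_set_def e_def infnorm_sub)
    qed
    have "L (x, a) - (\<Sum>i=1..?n. \<theta> i * L (?v i, ?u i)) \<le> \<sigma> * max_dist_pow N \<beta> {1..?n} ?v ?u"
      unfolding x_eq a_def
      using LL[unfolded assumption_L_def Let_def, rule_format, of ?v ?u \<theta>] vX assms(23) \<theta> by blast
    \<comment> \<open>Since the weights sum to one, the common bound can be split among the
      vertices, and each share is covered by its own \<open>\<kappa> (j i)\<close>.\<close>
    also have "\<dots> = (\<Sum>i=1..?n. \<theta> i * (\<sigma> * max_dist_pow N \<beta> {1..?n} ?v ?u))"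
      using \<theta>_sum by (simp flip: sum_distrib_right)
    also have "\<dots> \<le> (\<Sum>i=1..?n. \<theta> i * \<kappa> (j i))"
      unfolding kappa_eq kappa_def using \<theta>_nonneg dist_le \<open>0 \<le> \<sigma>\<close>
      by (intro sum_mono mult_left_mono) auto
    finally have L_le: "L (x, a) \<le> (\<Sum>i=1..?n. \<theta> i * (L (?v i, ?u i) + \<kappa> (j i)))"
      by (simp add: distrib_left sum.distrib)
    have "G a w \<le> M x + ereal d" if "w \<in> W" for w
    proof -
      \<comment> \<open>\<open>?r i\<close> is the height that the vertex inequality allows above
        the successor \<open>?y i\<close>. Averaging these points of the epigraph cancels the error
        and leaves the successor \<open>f (x, a) + w\<close>.\<close>
      let ?y = "\<lambda>i. f (?v i, ?u i) + (e + w)" and ?r = "\<lambda>i. ?t i + d - (L (?v i, ?u i) + \<kappa> (j i))"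
      have "(?y i, ?r i) \<in> cfg_poly G1 G2 h2 z" if i: "i \<in> {1..?n}" for i
      proof -
        have "e + w \<in> D (j i)"
          unfolding D_eq using e_in[OF i] \<open>w \<in> W\<close> by (rule set_plus_intro)
        from vertex[OF this] have "ereal (L (?v i, ?u i) + \<kappa> (j i)) + M (?y i) \<le> M (?v i) + ereal d"
          using vX[OF i] by (simp add: ind_fun_def)
        also have "\<dots> \<le> ereal (?t i + d)"
          using add_right_mono[OF Mv[OF i], of "ereal d"] by simp
        finally show ?thesis
          unfolding M_le[symmetric] by (cases "M (?y i)") auto
      qed
      then have "(\<Sum>i=1..?n. \<theta> i *\<^sub>R (?y i, ?r i)) \<in> cfg_poly G1 G2 h2 z"
        using \<theta>_nonneg \<theta>_sum by (intro convex_sum convex_cfg_poly) auto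
      moreover have "(\<Sum>i=1..?n. \<theta> i *\<^sub>R ?y i) = f (x, a) + w"
        using \<theta>_sum by (simp add: scaleR_add_right sum.distrib e_def flip: scaleR_left.sum)
      moreover have "(\<Sum>i=1..?n. \<theta> i * ?r i) = t + d - (\<Sum>i=1..?n. \<theta> i * (L (?v i, ?u i) + \<kappa> (j i)))"
        using \<theta>_sum
        by (simp add: right_diff_distrib distrib_left sum.distrib sum_subtractf t_eq flip: sum_distrib_right)
      ultimately have "M (f (x, a) + w) \<le> ereal (t + d - (\<Sum>i=1..?n. \<theta> i * (L (?v i, ?u i) + \<kappa> (j i))))"
        by (simp add: M_le sum_prod)
      also have "\<dots> \<le> ereal (t + d - L (x, a))"
        using L_le by simp
      finally show ?thesis
        unfolding G_def real using \<open>x \<in> X\<close> by (cases "M (f (x, a) + w)") (auto simp: ind_fun_def)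
    qed
    then have "g a \<le> M x + ereal d"
      by (simp add: g_le)
    moreover have "m \<le> g a"
      using m \<open>a \<in> U\<close> by (simp add: is_minimum_over_def INF_lower)
    ultimately show ?thesis by order
  qed
  with g m show "\<exists>g m. (\<forall>a\<in>U. is_maximum_over (\<lambda>w. ereal (L (x, a)) + ind_fun X x + M (f (x, a) + w)) W (g a)) \<and>
      is_minimum_over g U m \<and> M x + ereal d \<ge> m"
    unfolding G_def by (intro exI conjI ballI)
qed

end
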